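(* (The SLOPE thresholding operator.) Let $X\in\mathbb{R}^{n\times p}$, $y\in\mathbb{R}^n$, let $\lambda_1\ge\cdots\ge\lambda_p\ge0$, let $\beta\in\mathbb{R}^p$ have $m$ clusters $\mathcal{C}_1,\dots,\mathcal{C}_m$ with values $c_1>\cdots>c_m\ge0$, and let $k\in\{1,\dots,m\}$. Let $c^{\setminus k}=\{c_1,\dots,c_{k-1},c_{k+1},\dots,c_m\}$, with elements written in decreasing order as $c^{\setminus k}_1>c^{\setminus k}_2>\cdots$. Let $\varepsilon_c>0$ satisfy $\varepsilon_c<|c_i-c_j|$ for all $i\neq j$, and $\varepsilon_c<c_m$ if $c_m\ne0$. Define $S(x)=\sum_{j\in C(x)}\lambda_{(j)^-_x}$ and, for real $\gamma$ and $\omega$, let $$T(\gamma;\omega,c^{\setminus k},\lambda)=\begin{cases}0 & \text{if } |\gamma|\le S(\varepsilon_c),\\[1ex] \operatorname{sign}(\gamma)\,c^{\setminus k}_i & \text{if } \omega c^{\setminus k}_i+S(c^{\setminus k}_i-\varepsilon_c)\le|\gamma|\le\omega c^{\setminus k}_i+S(c^{\setminus k}_i+\varepsilon_c),\\[1ex] \dfrac{\operatorname{sign}(\gamma)}{\omega}\bigl(|\gamma|-S(c^{\setminus k}_i+\varepsilon_c)\bigr) & \text{if } \omega c^{\setminus k}_i+S(c^{\setminus k}_i+\varepsilon_c)<|\gamma|<\omega c^{\setminus k}_{i-1}+S(c^{\setminus k}_{i-1}-\varepsilon_c),\\[1ex] \dfrac{\operatorname{sign}(\gamma)}{\omega}\bigl(|\gamma|-S(c^{\setminus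 k}_1+\varepsilon_c)\bigr) & \text{if } |\gamma|\ge\omega c^{\setminus k}_1+S(c^{\setminus k}_1+\varepsilon_c).\end{cases}$$ Let $\tilde x=X_{\mathcal{C}_k}\operatorname{sign}(\beta_{\mathcal{C}_k})$ and $r=y-X\beta$. Then $$T\bigl(c_k\|\tilde x\|^2+\tilde x^{T}r;\ \|\tilde x\|^2,\ c^{\setminus k},\ \lambda\bigr)=\operatorname*{arg\,min}_{z\in\mathbb{R}}G(z),$$ where $G(z)=\tfrac12\|y-X\beta(z)\|^2+H(z)$.
   Context: Conventions: $\operatorname{sign}(x)=x/|x|$ for $x\neq0$, $\operatorname{sign}(0)=1$, applied entrywise to vectors; $\|\cdot\|$ is the Euclidean norm; $X_{:j}$ is the $j$-th column of $X$; $X_{\mathcal{C}_k}$ and $\beta_{\mathcal{C}_k}$ are the columns of $X$ and the entries of $\beta$ indexed by $\mathcal{C}_k$, so $X_{\mathcal{C}_k}\operatorname{sign}(\beta_{\mathcal{C}_k})=\sum_{j\in\mathcal{C}_k}\operatorname{sign}(\beta_j)X_{:j}\in\mathbb{R}^n$. Clusters: for a fixed $\beta\in\mathbb{R}^p$ such that $|\beta_j|$ takes exactly $m$ distinct values $c_1>\cdots>c_m\ge0$, the clusters are $\mathcal{C}_i=\{j:|\beta_j|=c_i\}$. For $z\in\mathbb{R}$ define $\beta(z)\in\mathbb{R}^p$ by $\beta_i(z)=\operatorname{sign}(\beta_i)\,z$ if $i\in\mathcal{C}_k$ and $\beta_i(z)=\beta_i$ otherwise. Sorting permutation: for $z\in\mathbb{R}$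 let $i\mapsto(i)_z$ be a permutation of $\{1,\dots,p\}$ with $|\beta(z)_{(1)_z}|\ge\cdots\ge|\beta(z)_{(p)_z}|$, and let $j\mapsto(j)^-_z$ be its inverse (the rank of index $j$ in the non-increasing ordering of $|\beta(z)|$; the permutation need not be unique, which does not affect the results). $C(z)=\{j:|\beta(z)_j|=|z|\}$. Partial sorted $\ell_1$ norm with respect to the $k$-th cluster: $$H(z)=|z|\sum_{j\in\mathcal{C}_k}\lambda_{(j)^-_z}+\sum_{j\notin\mathcal{C}_k}|\beta_j|\,\lambda_{(j)^-_z}.$$ Thus $G(z)=P(\beta(z))$, where $P(\beta)=\tfrac12\|y-X\beta\|^2+\sum_{j=1}^p\lambda_j|\beta_{(j)}|$, with $|\beta_{(1)}|\ge\cdots\ge|\beta_{(p)}|$. In the second and third cases of the definition of $T$, the condition is understood for an index $i$ for which the quantities involved are defined.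
   Formalization: Where none of the four cases of T applies (below the plateau of the smallest element of c^{\k}, or c^{\k} empty, with |γ|>S(ε_c)), T is set to sign(γ)(|γ|−S(ε_c))/ω; "= arg min" means T is a minimiser, and the only one when x̃≠0. *)

theory Defs
  imports "HOL-Analysis.Analysis"
begin

text \<open>Unlike the library function \<open>sgn\<close>, this sign takes the value 1 at 0.\<close>

definition sign1 :: "real \<Rightarrow> real" where
  "sign1 x = (if x = 0 then 1 else x / \<bar>x\<bar>)"

definition cluster_values :: "real ^ 'p \<Rightarrow> nat \<Rightarrow> (nat \<Rightarrow> real) \<Rightarrow> bool" where
  "cluster_values \<beta> m c \<longleftrightarrow>
     (\<forall>i\<in>{1..m}. \<forall>j\<in>{1..m}. i < j \<longrightarrow> c i > c j) \<and> c ` {1..m} = {\<bar>\<beta> $ j\<bar> | j. True}"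

definition cluster :: "real ^ 'p \<Rightarrow> real \<Rightarrow> 'p set" where
  "cluster \<beta> v = {j. \<bar>\<beta> $ j\<bar> = v}"

text \<open>In what follows \<open>v\<close> is the value \<open>c\<^sub>k\<close> of the cluster being updated.\<close>

definition beta_at :: "real ^ 'p \<Rightarrow> real \<Rightarrow> real \<Rightarrow> real ^ 'p" where
  "beta_at \<beta> v z = (\<chi> i. if i \<in> cluster \<beta> v then sign1 (\<beta> $ i) * z else \<beta> $ i)"

text \<open>
  Coordinates are indexed by the finite type \<open>'p\<close>, ranks by \<open>{1..CARD('p)}\<close>.
  Since the sorting permutation need not be unique, it is a parameter:
  \<open>\<sigma> z i\<close> is the coordinate \<open>(i)\<^sub>z\<close>.
\<close>

definition sorts :: "(nat \<Rightarrow> 'p) \<Rightarrow> real ^ 'p \<Rightarrow> bool" where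
  "sorts \<pi> b \<longleftrightarrow> bij_betw \<pi> {1..CARD('p)} UNIV \<and>
     (\<forall>i\<in>{1..CARD('p)}. \<forall>j\<in>{1..CARD('p)}. i \<le> j \<longrightarrow> \<bar>b $ \<pi> i\<bar> \<ge> \<bar>b $ \<pi> j\<bar>)"

definition rank_of :: "(nat \<Rightarrow> 'p) \<Rightarrow> 'p \<Rightarrow> nat" where
  "rank_of \<pi> j = inv_into {1..CARD('p)} \<pi> j"

definition tie_set :: "real ^ 'p \<Rightarrow> real \<Rightarrow> real \<Rightarrow> 'p set" where
  "tie_set \<beta> v z = {j. \<bar>beta_at \<beta> v z $ j\<bar> = \<bar>z\<bar>}"

definition S_sum ::
  "(real \<Rightarrow> nat \<Rightarrow> 'p) \<Rightarrow> (nat \<Rightarrow> real) \<Rightarrow> real ^ 'p \<Rightarrow> real \<Rightarrow> real \<Rightarrow> real" where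
  "S_sum \<sigma> lam \<beta> v x = (\<Sum>j\<in>tie_set \<beta> v x. lam (rank_of (\<sigma> x) j))"

definition H_norm ::
  "(real \<Rightarrow> nat \<Rightarrow> 'p) \<Rightarrow> (nat \<Rightarrow> real) \<Rightarrow> real ^ 'p \<Rightarrow> real \<Rightarrow> real \<Rightarrow> real" where
  "H_norm \<sigma> lam \<beta> v z =
     \<bar>z\<bar> * (\<Sum>j\<in>cluster \<beta> v. lam (rank_of (\<sigma> z) j))
     + (\<Sum>j\<in>- cluster \<beta> v. \<bar>\<beta> $ j\<bar> * lam (rank_of (\<sigma> z) j))"

definition G_obj ::
  "(real \<Rightarrow> nat \<Rightarrow> 'p) \<Rightarrow> (nat \<Rightarrow> real) \<Rightarrow> real ^ 'p ^ 'n \<Rightarrow> real ^ 'n \<Rightarrow>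
   real ^ 'p \<Rightarrow> real \<Rightarrow> real \<Rightarrow> real" where
  "G_obj \<sigma> lam X y \<beta> v z =
     1 / 2 * (norm (y - X *v beta_at \<beta> v z))\<^sup>2 + H_norm \<sigma> lam \<beta> v z"

definition x_tilde :: "real ^ 'p ^ 'n \<Rightarrow> real ^ 'p \<Rightarrow> real \<Rightarrow> real ^ 'n" where
  "x_tilde X \<beta> v = (\<Sum>j\<in>cluster \<beta> v. sign1 (\<beta> $ j) *\<^sub>R column j X)"

text \<open>The \<open>i\<close>-th largest element of a finite set, counting from 1.\<close>

definition nth_largest :: "real set \<Rightarrow> nat \<Rightarrow> real" where
  "nth_largest A i = rev (sorted_list_of_set A) ! (i - 1)"

text \<open>
  The thresholding operator. \<open>A\<close> is the set of values of the other clusters; the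
  dependence on \<open>\<lambda>\<close> is only through the function \<open>S\<close>. The first four branches are the
  usual four-case definition. For \<open>S = S_sum \<sigma> \<lambda> \<beta> (c k)\<close>, \<open>A = {c i | i \<noteq> k}\<close> and \<open>\<omega> > 0\<close> these
  leave out the inputs strictly between \<open>S \<epsilon>\<close> and the plateau of the smallest (positive)
  element of \<open>A\<close>, and the inputs with \<open>\<bar>\<gamma>\<bar> > S \<epsilon>\<close> when \<open>A = {}\<close>. The final branch covers
  exactly these, by the formula of the third case at a fictitious further element 0 of \<open>A\<close>.
\<close>

definition slope_threshold ::
  "(real \<Rightarrow> real) \<Rightarrow> real \<Rightarrow> real \<Rightarrow> real \<Rightarrow> real set \<Rightarrow> real" where
  "slope_threshold S \<epsilon> \<gamma> \<omega> A =
    (let d = nth_largest A;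
         plateau = (\<lambda>i. i \<in> {1..card A} \<and>
            \<omega> * d i + S (d i - \<epsilon>) \<le> \<bar>\<gamma>\<bar> \<and> \<bar>\<gamma>\<bar> \<le> \<omega> * d i + S (d i + \<epsilon>));
         between = (\<lambda>i. i \<in> {2..card A} \<and>
            \<omega> * d i + S (d i + \<epsilon>) < \<bar>\<gamma>\<bar> \<and>
            \<bar>\<gamma>\<bar> < \<omega> * d (i - 1) + S (d (i - 1) - \<epsilon>))
     in if \<bar>\<gamma>\<bar> \<le> S \<epsilon> then 0
        else if \<exists>i. plateau i then sign1 \<gamma> * d (SOME i. plateau i)
        else if \<exists>i. between i then
          sign1 \<gamma> / \<omega> * (\<bar>\<gamma>\<bar> - S (d (SOME i. between i) + \<epsilon>))
        else if A \<noteq> {} \<and> \<bar>\<gamma>\<bar> \<ge> \<omega> * d 1 + S (d 1 + \<epsilon>) then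
          sign1 \<gamma> / \<omega> * (\<bar>\<gamma>\<bar> - S (d 1 + \<epsilon>))
        else sign1 \<gamma> / \<omega> * (\<bar>\<gamma>\<bar> - S \<epsilon>))"

end

theory Submission
  imports Defs
begin

text \<open>
  For a fixed permutation the sorted norm of \<open>\<beta>(z)\<close> is affine in \<open>\<bar>z\<bar>\<close>, and by the rearrangement
  inequality \<open>H\<close> is the maximum of these affine functions over all permutations, attained at
  the sorting ones. Hence \<open>S x\<close> is a subgradient of \<open>H\<close> at every \<open>t\<close> such that no value of another
  cluster separates \<open>t\<close> from \<open>x\<close>, and \<open>S\<close> is constant between two consecutive such values.
  Since \<open>G z = \<omega> z\<^sup>2 / 2 - \<gamma> z + H z\<close> up to a constant, with \<open>\<omega> = \<parallel>x\<parallel>\<^sup>2\<close> for the signed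
  column sum \<open>x\<close> of the cluster, it remains to find \<open>t \<ge> 0\<close> and a subgradient \<open>s\<close> at \<open>t\<close> such that
  \<open>\<bar>\<gamma>\<bar> = \<omega> t + s\<close>, or \<open>t = 0\<close> and \<open>\<bar>\<gamma>\<bar> \<le> s\<close>; each case of the thresholding operator supplies such a pair.
\<close>

lemma sum_image_le_sum_sorted:
  fixes b :: "'a \<Rightarrow> real" and n l :: nat
  assumes inj: "inj_on \<pi> {1..n}" "inj_on \<rho> {1..n}"
    and range: "\<rho> ` {1..n} \<subseteq> \<pi> ` {1..n}"
    and sorted: "\<And>i j. 1 \<le> i \<Longrightarrow> i \<le> j \<Longrightarrow> j \<le> n \<Longrightarrow> b (\<pi> j) \<le> b (\<pi> i)"
    and l: "l \<le> n"
  shows "(\<Sum>i=1..l. b (\<rho> i)) \<le> (\<Sum>i=1..l. b (\<pi> i))"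
proof (cases "l = 0")
  case False
  define P where "P = \<pi> ` {1..l}"
  define R where "R = \<rho> ` {1..l}"
  have fin: "finite P" "finite R" by (auto simp: P_def R_def)
  have inj_l: "inj_on \<pi> {1..l}" "inj_on \<rho> {1..l}"
    using inj l by (auto intro: inj_on_subset)
  have card_eq: "card P = card R"
    unfolding P_def R_def card_image[OF inj_l(1)] card_image[OF inj_l(2)] ..
  have card_diff: "card (P - R) = card (R - P)"
  proof -
    have "card (P - R) = card P - card (P \<inter> R)" "card (R - P) = card R - card (R \<inter> P)"
      using fin by (auto simp: card_Diff_subset_Int)
    then show ?thesis using card_eq by (simp add: Int_commute)
  qed
  have le: "b x \<le> b (\<pi> l)" if "x \<in> R - P" for x
  proof -
    have "x \<in> \<rho> ` {1..n}" using that l by (auto simp: R_def)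
    then obtain i where i: "i \<in> {1..n}" "x = \<pi> i" using range by auto
    then have "\<not> i \<le> l" using that by (auto simp: P_def)
    then show ?thesis using sorted[of l i] i False by auto
  qed
  have ge: "b (\<pi> l) \<le> b x" if "x \<in> P - R" for x
    using that sorted[of _ l] l by (auto simp: P_def)
  have "sum b (R - P) \<le> of_nat (card (R - P)) * b (\<pi> l)"
    by (rule sum_bounded_above) (use le in auto)
  also have "\<dots> \<le> sum b (P - R)"
    unfolding card_diff[symmetric] by (rule sum_bounded_below) (use ge in auto)
  finally have "sum b (R - P) + sum b (P \<inter> R) \<le> sum b (P - R) + sum b (P \<inter> R)" by simp
  then have "sum b R \<le> sum b P"
    using sum.Int_Diff[OF fin(1), of b R] sum.Int_Diff[OF fin(2), of b P]
    by (simp add: Int_commute add.commute)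
  then show ?thesis
    unfolding P_def R_def sum.reindex[OF inj_l(1)] sum.reindex[OF inj_l(2)] by simp
qed simp

lemma abel_sum_ge:
  fixes f e :: "nat \<Rightarrow> real"
  assumes "1 \<le> n" and "\<And>i j. 1 \<le> i \<Longrightarrow> i \<le> j \<Longrightarrow> j \<le> n \<Longrightarrow> f j \<le> f i"
    and "\<And>l. l < n \<Longrightarrow> 0 \<le> (\<Sum>i=1..l. e i)"
  shows "f n * (\<Sum>i=1..n. e i) \<le> (\<Sum>i=1..n. f i * e i)"
  using assms
proof (induction n rule: nat_induct_at_least)
  case (Suc n)
  have "f (Suc n) * (\<Sum>i=1..n. e i) \<le> f n * (\<Sum>i=1..n. e i)"
    using Suc.prems Suc.hyps by (intro mult_right_mono) auto
  moreover have "f n * (\<Sum>i=1..n. e i) \<le> (\<Sum>i=1..n. f i * e i)"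
    using Suc.prems by (intro Suc.IH) auto
  ultimately show ?case by (simp add: distrib_left)
qed simp

lemma rearrangement_le:
  fixes b :: "'a \<Rightarrow> real" and f :: "nat \<Rightarrow> real"
  assumes inj: "inj_on \<pi> {1..n}" "inj_on \<rho> {1..n}"
    and range: "\<rho> ` {1..n} = \<pi> ` {1..n}"
    and sorted: "\<And>i j. 1 \<le> i \<Longrightarrow> i \<le> j \<Longrightarrow> j \<le> n \<Longrightarrow> b (\<pi> j) \<le> b (\<pi> i)"
    and f: "\<And>i j. 1 \<le> i \<Longrightarrow> i \<le> j \<Longrightarrow> j \<le> n \<Longrightarrow> f j \<le> f i"
  shows "(\<Sum>i=1..n. f i * b (\<rho> i)) \<le> (\<Sum>i=1..n. f i * b (\<pi> i))"
proof (cases "n = 0")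
  case False
  let ?e = "\<lambda>i. b (\<pi> i) - b (\<rho> i)"
  have "sum b (\<rho> ` {1..n}) = sum b (\<pi> ` {1..n})" by (simp only: range)
  then have "(\<Sum>i=1..n. ?e i) = 0"
    unfolding sum.reindex[OF inj(1)] sum.reindex[OF inj(2)] by (simp add: sum_subtractf)
  moreover have "f n * (\<Sum>i=1..n. ?e i) \<le> (\<Sum>i=1..n. f i * ?e i)"
    using False f sum_image_le_sum_sorted[where b = b, OF inj _ sorted] range
    by (intro abel_sum_ge) (auto simp: sum_subtractf)
  ultimately show ?thesis by (simp add: right_diff_distrib sum_subtractf)
qed simp

definition perm_norm :: "(nat \<Rightarrow> real) \<Rightarrow> (nat \<Rightarrow> 'p) \<Rightarrow> real ^ 'p \<Rightarrow> real" where
  "perm_norm lam \<pi> b = (\<Sum>j\<in>UNIV. \<bar>b $ j\<bar> * lam (rank_of \<pi> j))"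

definition cluster_slope :: "(nat \<Rightarrow> real) \<Rightarrow> (nat \<Rightarrow> 'p) \<Rightarrow> real ^ 'p \<Rightarrow> real \<Rightarrow> real" where
  "cluster_slope lam \<pi> \<beta> v = (\<Sum>j\<in>cluster \<beta> v. lam (rank_of \<pi> j))"

lemma rank_of_bounds:
  fixes \<pi> :: "nat \<Rightarrow> 'p::finite"
  assumes "bij_betw \<pi> {1..CARD('p)} UNIV"
  shows "rank_of \<pi> j \<in> {1..CARD('p)}"
  using assms unfolding rank_of_def by (intro inv_into_into) (simp add: bij_betw_def)

lemma perm_norm_by_rank:
  fixes b :: "real ^ 'p"
  assumes "bij_betw \<pi> {1..CARD('p)} UNIV"
  shows "perm_norm lam \<pi> b = (\<Sum>i=1..CARD('p). lam i * \<bar>b $ \<pi> i\<bar>)"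
proof -
  have "perm_norm lam \<pi> b = (\<Sum>i=1..CARD('p). \<bar>b $ \<pi> i\<bar> * lam (rank_of \<pi> (\<pi> i)))"
    unfolding perm_norm_def by (rule sum.reindex_bij_betw[OF assms, symmetric])
  also have "\<dots> = (\<Sum>i=1..CARD('p). lam i * \<bar>b $ \<pi> i\<bar>)"
    using assms by (intro sum.cong) (auto simp: rank_of_def bij_betw_def)
  finally show ?thesis .
qed

lemma perm_norm_le_sorted:
  fixes b :: "real ^ 'p"
  assumes "sorts \<pi> b" and "bij_betw \<rho> {1..CARD('p)} UNIV"
    and lam: "\<And>i j. i \<in> {1..CARD('p)} \<Longrightarrow> j \<in> {1..CARD('p)} \<Longrightarrow> i \<le> j \<Longrightarrow> lam j \<le> lam i"
  shows "perm_norm lam \<rho> b \<le> perm_norm lam \<pi> b"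
proof -
  have bij: "bij_betw \<pi> {1..CARD('p)} UNIV" using assms by (simp add: sorts_def)
  show ?thesis
    unfolding perm_norm_by_rank[OF bij] perm_norm_by_rank[OF assms(2)]
    using assms bij
    by (intro rearrangement_le[where b = "\<lambda>j. \<bar>b $ j\<bar>"]) (auto simp: sorts_def bij_betw_def)
qed

lemma abs_sign1 [simp]: "\<bar>sign1 x\<bar> = 1"
  by (simp add: sign1_def)

lemma sign1_mult_abs: "sign1 x * \<bar>x\<bar> = x"
  by (simp add: sign1_def)

lemma abs_beta_at:
  "\<bar>beta_at \<beta> v z $ j\<bar> = (if j \<in> cluster \<beta> v then \<bar>z\<bar> else \<bar>\<beta> $ j\<bar>)"
  by (simp add: beta_at_def abs_mult)

lemma perm_norm_beta_at:
  "perm_norm lam \<pi> (beta_at \<beta> v z) =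
     \<bar>z\<bar> * cluster_slope lam \<pi> \<beta> v + (\<Sum>j\<in>- cluster \<beta> v. \<bar>\<beta> $ j\<bar> * lam (rank_of \<pi> j))"
proof -
  have "perm_norm lam \<pi> (beta_at \<beta> v z) =
      (\<Sum>j\<in>cluster \<beta> v \<union> - cluster \<beta> v. \<bar>beta_at \<beta> v z $ j\<bar> * lam (rank_of \<pi> j))"
    by (simp add: perm_norm_def)
  also have "\<dots> = (\<Sum>j\<in>cluster \<beta> v. \<bar>beta_at \<beta> v z $ j\<bar> * lam (rank_of \<pi> j))
      + (\<Sum>j\<in>- cluster \<beta> v. \<bar>beta_at \<beta> v z $ j\<bar> * lam (rank_of \<pi> j))"
    by (intro sum.union_disjoint) auto
  finally show ?thesis
    by (simp add: abs_beta_at cluster_slope_def sum_distrib_left)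
qed

lemma H_norm_eq_perm_norm: "H_norm \<sigma> lam \<beta> v z = perm_norm lam (\<sigma> z) (beta_at \<beta> v z)"
  by (simp add: H_norm_def perm_norm_beta_at cluster_slope_def)

lemma S_sum_eq_cluster_slope:
  assumes "\<And>j. j \<notin> cluster \<beta> v \<Longrightarrow> \<bar>\<beta> $ j\<bar> \<noteq> \<bar>x\<bar>"
  shows "S_sum \<sigma> lam \<beta> v x = cluster_slope lam (\<sigma> x) \<beta> v"
proof -
  have "tie_set \<beta> v x = cluster \<beta> v"
    using assms by (auto simp: tie_set_def abs_beta_at)
  then show ?thesis by (simp add: S_sum_def cluster_slope_def)
qed

lemma sorts_beta_at_same_gap:
  assumes "sorts \<pi> (beta_at \<beta> v x)"
    and gap: "\<And>j. j \<notin> cluster \<beta> v \<Longrightarrow>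
      \<bar>\<beta> $ j\<bar> < \<bar>x\<bar> \<and> \<bar>\<beta> $ j\<bar> \<le> \<bar>t\<bar> \<or> \<bar>x\<bar> < \<bar>\<beta> $ j\<bar> \<and> \<bar>t\<bar> \<le> \<bar>\<beta> $ j\<bar>"
  shows "sorts \<pi> (beta_at \<beta> v t)"
proof -
  have "\<bar>beta_at \<beta> v t $ b\<bar> \<le> \<bar>beta_at \<beta> v t $ a\<bar>"
    if "\<bar>beta_at \<beta> v x $ b\<bar> \<le> \<bar>beta_at \<beta> v x $ a\<bar>" for a b
    using that gap[of a] gap[of b] by (auto simp: abs_beta_at split: if_splits)
  then show ?thesis using assms(1) by (simp add: sorts_def)
qed

lemma H_norm_subgradient:
  fixes \<beta> :: "real ^ 'p"
  assumes sorting: "\<And>z. sorts (\<sigma> z) (beta_at \<beta> v z)"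
    and lam: "\<And>i j. i \<in> {1..CARD('p)} \<Longrightarrow> j \<in> {1..CARD('p)} \<Longrightarrow> i \<le> j \<Longrightarrow> lam j \<le> lam i"
    and gap: "\<And>j. j \<notin> cluster \<beta> v \<Longrightarrow>
      \<bar>\<beta> $ j\<bar> < \<bar>x\<bar> \<and> \<bar>\<beta> $ j\<bar> \<le> \<bar>t\<bar> \<or> \<bar>x\<bar> < \<bar>\<beta> $ j\<bar> \<and> \<bar>t\<bar> \<le> \<bar>\<beta> $ j\<bar>"
  shows "H_norm \<sigma> lam \<beta> v t + S_sum \<sigma> lam \<beta> v x * (\<bar>z\<bar> - \<bar>t\<bar>) \<le> H_norm \<sigma> lam \<beta> v z"
proof -
  have bij: "bij_betw (\<sigma> w) {1..CARD('p)} UNIV" for w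
    using sorting[of w] by (simp add: sorts_def)
  have "S_sum \<sigma> lam \<beta> v x = cluster_slope lam (\<sigma> x) \<beta> v"
    using gap by (intro S_sum_eq_cluster_slope) fastforce
  moreover have "perm_norm lam (\<sigma> t) (beta_at \<beta> v t) \<le> perm_norm lam (\<sigma> x) (beta_at \<beta> v t)"
    using sorts_beta_at_same_gap[OF sorting gap] bij lam by (rule perm_norm_le_sorted)
  moreover have "perm_norm lam (\<sigma> x) (beta_at \<beta> v z) \<le> perm_norm lam (\<sigma> z) (beta_at \<beta> v z)"
    using sorting bij lam by (rule perm_norm_le_sorted)
  ultimately show ?thesis
    unfolding H_norm_eq_perm_norm
    by (simp add: perm_norm_beta_at[of _ "\<sigma> x"] algebra_simps)
qed

lemma matrix_vector_beta_at:
  "X *v beta_at \<beta> v z = X *v \<beta> + (z - v) *\<^sub>R x_tilde X \<beta> v"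
proof -
  have "beta_at \<beta> v z $ j = \<beta> $ j + (if j \<in> cluster \<beta> v then (z - v) * sign1 (\<beta> $ j) else 0)" for j
    using sign1_mult_abs[of "\<beta> $ j"] by (auto simp: beta_at_def cluster_def algebra_simps)
  then have "X *v beta_at \<beta> v z = (\<Sum>j\<in>UNIV. \<beta> $ j *\<^sub>R column j X
      + (if j \<in> cluster \<beta> v then ((z - v) * sign1 (\<beta> $ j)) *\<^sub>R column j X else 0))"
    by (auto simp: matrix_mult_sum scalar_mult_eq_scaleR scaleR_left_distrib intro!: sum.cong)
  also have "\<dots> = X *v \<beta> + (z - v) *\<^sub>R x_tilde X \<beta> v"
    by (simp add: sum.distrib matrix_mult_sum scalar_mult_eq_scaleR x_tilde_def
        scaleR_sum_right sum.If_cases)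
  finally show ?thesis .
qed

lemma G_obj_quadratic:
  fixes X :: "real ^ 'p ^ 'n" and \<beta> :: "real ^ 'p" and y :: "real ^ 'n" and v :: real
  defines "xt \<equiv> x_tilde X \<beta> v" and "r \<equiv> y - X *v \<beta>"
  shows "G_obj \<sigma> lam X y \<beta> v z =
    ((norm r)\<^sup>2 / 2 + v * inner xt r + (norm xt)\<^sup>2 * v\<^sup>2 / 2) + (norm xt)\<^sup>2 * z\<^sup>2 / 2
     - (v * (norm xt)\<^sup>2 + inner xt r) * z + H_norm \<sigma> lam \<beta> v z"
proof -
  have residual: "y - X *v beta_at \<beta> v z = r - (z - v) *\<^sub>R xt"
    by (simp add: matrix_vector_beta_at xt_def r_def)
  have "(norm (y - X *v beta_at \<beta> v z))\<^sup>2 =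
      (norm r)\<^sup>2 - 2 * (z - v) * inner xt r + (z - v)\<^sup>2 * (norm xt)\<^sup>2"
    unfolding residual power2_norm_eq_inner
    by (simp add: inner_diff_left inner_diff_right inner_commute[of r xt] power2_eq_square)
      (simp add: algebra_simps)
  then show ?thesis
    by (simp add: G_obj_def field_simps power2_eq_square)
qed

lemma arg_min_of_subgradient:
  fixes H G :: "real \<Rightarrow> real"
  assumes G: "\<And>z. G z = q + \<omega> * z\<^sup>2 / 2 - \<gamma> * z + H z"
    and \<omega>: "0 \<le> \<omega>" and T: "T = sign1 \<gamma> * t" and t: "0 \<le> t"
    and sub: "\<And>z. H T + s * (\<bar>z\<bar> - t) \<le> H z"
    and opt: "\<bar>\<gamma>\<bar> = \<omega> * t + s \<or> t = 0 \<and> \<bar>\<gamma>\<bar> \<le> s"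
    and zero: "\<gamma> = 0 \<Longrightarrow> t = 0"
  shows "is_arg_min G (\<lambda>_. True) T"
    and "0 < \<omega> \<Longrightarrow> is_arg_min G (\<lambda>_. True) z \<Longrightarrow> z = T"
proof -
  have \<gamma>T: "\<gamma> * T = \<bar>\<gamma>\<bar> * t"
    by (auto simp: T sign1_def abs_if)
  have T2: "T\<^sup>2 = t\<^sup>2"
    by (simp add: T power2_eq_iff abs_mult flip: power2_abs[of "sign1 \<gamma> * t"])
  have gap: "G T + \<omega> * (\<bar>z\<bar> - t)\<^sup>2 / 2 + (\<bar>\<gamma>\<bar> * \<bar>z\<bar> - \<gamma> * z) \<le> G z" for z
  proof -
    have z2: "z\<^sup>2 = \<bar>z\<bar>\<^sup>2" by simp
    have "(\<bar>\<gamma>\<bar> - \<omega> * t - s) * (\<bar>z\<bar> - t) \<le> 0"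
      using opt by (auto simp: mult_nonpos_nonneg)
    then show ?thesis
      using sub[of z] unfolding G \<gamma>T T2 z2
      by (simp add: power2_eq_square field_simps)
  qed
  have cs: "\<gamma> * z \<le> \<bar>\<gamma>\<bar> * \<bar>z\<bar>" for z
    by (metis abs_ge_self abs_mult)
  have sq: "0 \<le> \<omega> * (\<bar>z\<bar> - t)\<^sup>2 / 2" for z using \<omega> by simp
  have min: "G T \<le> G z" for z
    using gap[of z] cs[of z] sq[of z] by linarith
  then show "is_arg_min G (\<lambda>_. True) T"
    by (simp add: is_arg_min_def not_less)
  show "z = T" if "0 < \<omega>" "is_arg_min G (\<lambda>_. True) z"
  proof -
    have "G z \<le> G T" using that by (simp add: is_arg_min_def not_less)
    then have "\<omega> * (\<bar>z\<bar> - t)\<^sup>2 / 2 = 0" and \<gamma>z: "\<gamma> * z = \<bar>\<gamma>\<bar> * \<bar>z\<bar>"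
      using gap[of z] cs[of z] sq[of z] by linarith+
    then have zt: "\<bar>z\<bar> = t" using that by simp
    show ?thesis
    proof (cases "\<gamma> = 0")
      case True
      then show ?thesis using zero zt T by simp
    next
      case False
      then have "z = \<bar>\<gamma>\<bar> * \<bar>z\<bar> / \<gamma>" using \<gamma>z by (simp add: field_simps)
      then show ?thesis using False zt by (simp add: T sign1_def abs_if split: if_splits)
    qed
  qed
qed

lemma nth_largest_in:
  assumes "finite A" "i \<in> {1..card A}"
  shows "nth_largest A i \<in> A"
proof -
  have "rev (sorted_list_of_set A) ! (i - 1) \<in> set (rev (sorted_list_of_set A))"
    using assms by (intro nth_mem) auto
  then show ?thesis using assms by (simp add: nth_largest_def)
qed

lemma nth_largest_strict_antimono:
  assumes "finite A" "1 \<le> i" "i < j" "j \<le> card A"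
  shows "nth_largest A j < nth_largest A i"
proof -
  have "sorted_wrt (<) (sorted_list_of_set A)" by simp
  then have "sorted_list_of_set A ! (card A - j) < sorted_list_of_set A ! (card A - i)"
    using assms by (auto intro: sorted_wrt_nth_less)
  then show ?thesis using assms by (simp add: nth_largest_def rev_nth)
qed

lemma nth_largest_exhausts:
  assumes "finite A" "a \<in> A"
  obtains i where "i \<in> {1..card A}" "a = nth_largest A i"
proof -
  have "a \<in> set (rev (sorted_list_of_set A))" using assms by simp
  then obtain n where "n < card A" "rev (sorted_list_of_set A) ! n = a"
    using assms by (auto simp: in_set_conv_nth simp del: set_rev)
  then show thesis using that[of "Suc n"] by (simp add: nth_largest_def)
qed

lemma slope_threshold_subgradient:
  fixes H S :: "real \<Rightarrow> real" and A :: "real set" and \<epsilon> \<gamma> \<omega> :: real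
  defines "T \<equiv> slope_threshold S \<epsilon> \<gamma> \<omega> A"
  assumes fin: "finite A"
    and eps: "0 < \<epsilon>"
    and A0: "\<And>a. a \<in> A \<Longrightarrow> a = 0 \<or> \<epsilon> < a"
    and sep: "\<And>a b. a \<in> A \<Longrightarrow> b \<in> A \<Longrightarrow> a \<noteq> b \<Longrightarrow> \<epsilon> < \<bar>a - b\<bar>"
    and S_nonneg: "0 \<le> S \<epsilon>"
    and sub: "\<And>x t z. 0 < x \<Longrightarrow> (\<And>a. a \<in> A \<Longrightarrow> a < x \<and> a \<le> \<bar>t\<bar> \<or> x < a \<and> \<bar>t\<bar> \<le> a) \<Longrightarrow>
      H t + S x * (\<bar>z\<bar> - \<bar>t\<bar>) \<le> H z"
    and \<omega>: "0 < \<omega> \<or> \<bar>\<gamma>\<bar> \<le> S \<epsilon>"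
  obtains t s where "T = sign1 \<gamma> * t" "0 \<le> t" "\<And>z. H T + s * (\<bar>z\<bar> - t) \<le> H z"
    "\<bar>\<gamma>\<bar> = \<omega> * t + s \<or> t = 0 \<and> \<bar>\<gamma>\<bar> \<le> s" "\<gamma> = 0 \<Longrightarrow> t = 0"
proof -
  note result = that
  define d where "d = nth_largest A"
  define N where "N = card A"
  define plateau where "plateau = (\<lambda>i. i \<in> {1..N} \<and>
    \<omega> * d i + S (d i - \<epsilon>) \<le> \<bar>\<gamma>\<bar> \<and> \<bar>\<gamma>\<bar> \<le> \<omega> * d i + S (d i + \<epsilon>))"
  define between where "between = (\<lambda>i. i \<in> {2..N} \<and>
    \<omega> * d i + S (d i + \<epsilon>) < \<bar>\<gamma>\<bar> \<and> \<bar>\<gamma>\<bar> < \<omega> * d (i - 1) + S (d (i - 1) - \<epsilon>))"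
  have T: "T = (if \<bar>\<gamma>\<bar> \<le> S \<epsilon> then 0
        else if \<exists>i. plateau i then sign1 \<gamma> * d (SOME i. plateau i)
        else if \<exists>i. between i then
          sign1 \<gamma> / \<omega> * (\<bar>\<gamma>\<bar> - S (d (SOME i. between i) + \<epsilon>))
        else if A \<noteq> {} \<and> \<omega> * d 1 + S (d 1 + \<epsilon>) \<le> \<bar>\<gamma>\<bar> then
          sign1 \<gamma> / \<omega> * (\<bar>\<gamma>\<bar> - S (d 1 + \<epsilon>))
        else sign1 \<gamma> / \<omega> * (\<bar>\<gamma>\<bar> - S \<epsilon>))"
    unfolding T_def slope_threshold_def Let_def d_def N_def plateau_def between_def by (rule refl)
  have d_in: "d i \<in> A" if "i \<in> {1..N}" for i
    using nth_largest_in[OF fin] that by (simp add: d_def N_def)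
  have d_less: "d j < d i" if "1 \<le> i" "i < j" "j \<le> N" for i j
    using nth_largest_strict_antimono[OF fin] that by (simp add: d_def N_def)
  have d_mono: "d j \<le> d i" if "1 \<le> i" "i \<le> j" "j \<le> N" for i j
    using d_less[of i j] that by (cases "i = j") auto
  have d_cases: "\<exists>i\<in>{1..N}. a = d i" if "a \<in> A" for a
    using nth_largest_exhausts[OF fin that] unfolding d_def N_def by metis
  have S_eq: "S x = S x'"
    if "0 < x" "0 < x'" "\<And>a. a \<in> A \<Longrightarrow> a < x \<and> a < x' \<or> x < a \<and> x' < a" for x x'
  proof -
    have "H w + S u * (\<bar>z\<bar> - \<bar>w\<bar>) \<le> H z" if "u \<in> {x, x'}" "w \<in> {x, x'}" for u w z
      using that \<open>0 < x\<close> \<open>0 < x'\<close> \<open>\<And>a. a \<in> A \<Longrightarrow> a < x \<and> a < x' \<or> x < a \<and> x' < a\<close>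
      by (intro sub) force+
    from this[of x x x'] this[of x x' x] this[of x' x x'] this[of x' x' x]
    have "S x * (x - x') = S x' * (x - x')"
      using that by (simp add: algebra_simps)
    then show ?thesis by auto
  qed
  have lin: thesis
    if "T = sign1 \<gamma> / \<omega> * (\<bar>\<gamma>\<bar> - S x)" "S \<epsilon> < \<bar>\<gamma>\<bar>" "0 < x" "0 \<le> \<bar>\<gamma>\<bar> - S x"
      "\<And>a. a \<in> A \<Longrightarrow> a < x \<and> \<omega> * a \<le> \<bar>\<gamma>\<bar> - S x \<or> x < a \<and> \<bar>\<gamma>\<bar> - S x \<le> \<omega> * a"
    for x
  proof -
    define t where "t = (\<bar>\<gamma>\<bar> - S x) / \<omega>"
    have \<omega>0: "0 < \<omega>" using \<omega> that by auto
    then have t: "0 \<le> t" "\<bar>\<gamma>\<bar> - S x = \<omega> * t" using that by (auto simp: t_def)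
    have Tt: "T = sign1 \<gamma> * t" using that(1) by (simp add: t_def)
    then have absT: "\<bar>T\<bar> = t" using t by (simp add: abs_mult)
    have "H T + S x * (\<bar>z\<bar> - \<bar>T\<bar>) \<le> H z" for z
    proof (rule sub[OF that(3)])
      fix a assume "a \<in> A"
      from that(5)[OF this] show "a < x \<and> a \<le> \<bar>T\<bar> \<or> x < a \<and> \<bar>T\<bar> \<le> a"
        using \<omega>0 unfolding t(2) absT by simp
    qed
    then show thesis
      using that(2) S_nonneg t Tt absT by (intro result[of t "S x"]) auto
  qed
  have A_nonneg: "0 \<le> a" if "a \<in> A" for a
    using A0[OF that] eps by auto
  have \<omega>_mono: "\<omega> * a \<le> \<omega> * b" if "S \<epsilon> < \<bar>\<gamma>\<bar>" "a \<le> b" for a b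
    using that \<omega> by (intro mult_left_mono) auto
  have separated: "a + \<epsilon> < b" if "a \<in> A" "b \<in> A" "a < b" for a b
    using sep[of a b] that by auto
  consider (zero) "\<bar>\<gamma>\<bar> \<le> S \<epsilon>"
    | (plateau) "S \<epsilon> < \<bar>\<gamma>\<bar>" "\<exists>i. plateau i"
    | (between) "S \<epsilon> < \<bar>\<gamma>\<bar>" "\<nexists>i. plateau i" "\<exists>i. between i"
    | (above) "S \<epsilon> < \<bar>\<gamma>\<bar>" "\<nexists>i. plateau i" "\<nexists>i. between i"
        "A \<noteq> {}" "\<omega> * d 1 + S (d 1 + \<epsilon>) \<le> \<bar>\<gamma>\<bar>"
    | (below) "S \<epsilon> < \<bar>\<gamma>\<bar>" "\<nexists>i. plateau i" "\<nexists>i. between i"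
        "A = {} \<or> \<bar>\<gamma>\<bar> < \<omega> * d 1 + S (d 1 + \<epsilon>)"
    by (meson not_le)
  then show thesis
  proof cases
    case zero
    then have T0: "T = 0" by (simp add: T)
    have "H 0 + S \<epsilon> * (\<bar>z\<bar> - \<bar>0\<bar>) \<le> H z" for z
      using eps A0 A_nonneg by (intro sub) force+
    then show thesis
      using zero T0 by (intro that[of 0 "S \<epsilon>"]) auto
  next
    case plateau
    define i where "i = (SOME i. plateau i)"
    have "plateau i" unfolding i_def using plateau(2) by (rule someI_ex)
    then have i: "i \<in> {1..N}" "\<omega> * d i + S (d i - \<epsilon>) \<le> \<bar>\<gamma>\<bar>" "\<bar>\<gamma>\<bar> \<le> \<omega> * d i + S (d i + \<epsilon>)"
      by (auto simp: plateau_def)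
    have Ti: "T = sign1 \<gamma> * d i" using plateau by (simp add: T i_def)
    have "d i \<noteq> 0" using i(3) plateau(1) by auto
    then have di: "\<epsilon> < d i" using A0[OF d_in[OF i(1)]] by simp
    then have absT: "\<bar>T\<bar> = d i" using eps by (simp add: Ti abs_mult)
    have gap: "a + \<epsilon> < d i \<or> a = d i \<or> d i + \<epsilon> < a" if "a \<in> A" for a
      using separated[OF that d_in[OF i(1)]] separated[OF d_in[OF i(1)] that] by linarith
    have right: "H T + S (d i + \<epsilon>) * (\<bar>z\<bar> - \<bar>T\<bar>) \<le> H z" for z
      using di eps gap by (intro sub) (force simp: absT)+
    have left: "H T + S (d i - \<epsilon>) * (\<bar>z\<bar> - \<bar>T\<bar>) \<le> H z" for z
      using di eps gap by (intro sub) (force simp: absT)+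
    define s where "s = \<bar>\<gamma>\<bar> - \<omega> * d i"
    have "H T + s * (\<bar>z\<bar> - d i) \<le> H z" for z
    proof (cases "d i \<le> \<bar>z\<bar>")
      case True
      then have "s * (\<bar>z\<bar> - d i) \<le> S (d i + \<epsilon>) * (\<bar>z\<bar> - d i)"
        using i by (intro mult_right_mono) (auto simp: s_def)
      then show ?thesis using right[of z] by (simp add: absT)
    next
      case False
      then have "s * (\<bar>z\<bar> - d i) \<le> S (d i - \<epsilon>) * (\<bar>z\<bar> - d i)"
        using i by (intro mult_right_mono_neg) (auto simp: s_def)
      then show ?thesis using left[of z] by (simp add: absT)
    qed
    then show thesis
      using Ti di eps plateau(1) S_nonneg by (intro that[of "d i" s]) (auto simp: s_def)
  next
    case between
    define i where "i = (SOME i. between i)"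
    have "between i" unfolding i_def using between(3) by (rule someI_ex)
    then have i: "i \<in> {2..N}" "\<omega> * d i + S (d i + \<epsilon>) < \<bar>\<gamma>\<bar>"
      "\<bar>\<gamma>\<bar> < \<omega> * d (i - 1) + S (d (i - 1) - \<epsilon>)"
      by (auto simp: between_def)
    have in_A: "d i \<in> A" "d (i - 1) \<in> A" using i(1) by (auto intro!: d_in)
    have less: "d i < d (i - 1)" using i(1) by (intro d_less) auto
    have pos: "\<epsilon> < d (i - 1)" using A0[OF in_A(2)] A_nonneg[OF in_A(1)] less by auto
    have dichotomy: "a \<le> d i \<or> d (i - 1) \<le> a" if "a \<in> A" for a
    proof -
      obtain j where j: "j \<in> {1..N}" "a = d j" using d_cases[OF \<open>a \<in> A\<close>] by blast
      show ?thesis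
      proof (cases "i \<le> j")
        case True
        then show ?thesis using i(1) j d_mono[of i j] by auto
      next
        case False
        then show ?thesis using i(1) j d_mono[of j "i - 1"] by auto
      qed
    qed
    note sep_i = separated[OF in_A less]
    have S_gap: "S (d i + \<epsilon>) = S (d (i - 1) - \<epsilon>)"
      using A_nonneg[OF in_A(1)] pos eps sep_i dichotomy by (intro S_eq) force+
    show thesis
    proof (rule lin[of "d i + \<epsilon>"])
      show "T = sign1 \<gamma> / \<omega> * (\<bar>\<gamma>\<bar> - S (d i + \<epsilon>))" using between by (auto simp: T i_def)
      show "0 \<le> \<bar>\<gamma>\<bar> - S (d i + \<epsilon>)"
        using i(2) \<omega>_mono[OF between(1) A_nonneg[OF in_A(1)]] by simp
      fix a assume "a \<in> A"
      then show "a < d i + \<epsilon> \<and> \<omega> * a \<le> \<bar>\<gamma>\<bar> - S (d i + \<epsilon>) \<or>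
          d i + \<epsilon> < a \<and> \<bar>\<gamma>\<bar> - S (d i + \<epsilon>) \<le> \<omega> * a"
        using dichotomy[of a] \<omega>_mono[OF between(1), of a "d i"]
          \<omega>_mono[OF between(1), of "d (i - 1)" a] i S_gap sep_i eps by auto
    qed (use between eps A_nonneg[OF in_A(1)] in auto)
  next
    case above
    have N: "1 \<le> N" using above(4) fin by (simp add: N_def Suc_le_eq card_gt_0_iff)
    have top: "a \<le> d 1" if "a \<in> A" for a
      using d_cases[OF that] d_mono by fastforce
    have d1: "0 \<le> d 1" using N by (intro A_nonneg d_in) auto
    show thesis
    proof (rule lin[of "d 1 + \<epsilon>"])
      show "T = sign1 \<gamma> / \<omega> * (\<bar>\<gamma>\<bar> - S (d 1 + \<epsilon>))" using above by (auto simp: T)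
      show "0 \<le> \<bar>\<gamma>\<bar> - S (d 1 + \<epsilon>)"
        using above(5) \<omega>_mono[OF above(1) d1] by simp
      fix a assume "a \<in> A"
      then show "a < d 1 + \<epsilon> \<and> \<omega> * a \<le> \<bar>\<gamma>\<bar> - S (d 1 + \<epsilon>) \<or>
          d 1 + \<epsilon> < a \<and> \<bar>\<gamma>\<bar> - S (d 1 + \<epsilon>) \<le> \<omega> * a"
        using top[of a] \<omega>_mono[OF above(1), of a "d 1"] above(5) eps by auto
    qed (use above eps d1 in auto)
  next
    case below
    have descend: "\<bar>\<gamma>\<bar> \<le> \<omega> * d i + S (d i + \<epsilon>) \<and> \<bar>\<gamma>\<bar> < \<omega> * d i + S (d i - \<epsilon>)"
      if "1 \<le> i" "i \<le> N" for i
      using that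
    proof (induction i rule: nat_induct_at_least)
      case base
      then have "A \<noteq> {}" by (auto simp: N_def)
      then have "\<bar>\<gamma>\<bar> < \<omega> * d 1 + S (d 1 + \<epsilon>)" using below(4) by simp
      moreover have "\<not> plateau 1" using below(2) by blast
      ultimately show ?case using base by (auto simp: plateau_def)
    next
      case (Suc i)
      have "\<not> plateau (Suc i)" "\<not> between (Suc i)" using below(2,3) by blast+
      then show ?case using Suc by (auto simp: plateau_def between_def)
    qed
    have far: "\<epsilon> < a \<and> \<bar>\<gamma>\<bar> - S \<epsilon> \<le> \<omega> * a" if "a \<in> A" for a
    proof -
      have N: "1 \<le> N" using that fin by (auto simp: N_def Suc_le_eq card_gt_0_iff)
      have bottom: "d N \<le> b" if "b \<in> A" for b
        using d_cases[OF that] d_mono by fastforce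
      have "d N \<noteq> 0" using descend[of N] N below(1) by auto
      then have dN: "\<epsilon> < d N" using A0[OF d_in[of N]] N by auto
      have "S \<epsilon> = S (d N - \<epsilon>)"
        using dN eps bottom by (intro S_eq) force+
      then show ?thesis
        using descend[of N] N dN bottom[OF that] \<omega>_mono[OF below(1), of "d N" a] by auto
    qed
    show thesis
    proof (rule lin[of \<epsilon>])
      show "T = sign1 \<gamma> / \<omega> * (\<bar>\<gamma>\<bar> - S \<epsilon>)" using below by (auto simp: T)
    qed (use below eps far in auto)
  qed
qed

theorem theorem2p3:
  fixes X :: "real ^ 'p ^ 'n" and y :: "real ^ 'n" and \<beta> :: "real ^ 'p"
    and lam :: "nat \<Rightarrow> real" and c :: "nat \<Rightarrow> real" and m k :: nat
    and \<epsilon> :: real and \<sigma> :: "real \<Rightarrow> nat \<Rightarrow> 'p"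
  assumes lam_decreasing:
      "\<And>i j. i \<in> {1..CARD('p)} \<Longrightarrow> j \<in> {1..CARD('p)} \<Longrightarrow> i \<le> j \<Longrightarrow> lam i \<ge> lam j"
    and lam_nonneg: "lam (CARD('p)) \<ge> 0"
    and clusters: "cluster_values \<beta> m c"
    and k: "k \<in> {1..m}"
    and eps_pos: "\<epsilon> > 0"
    and eps_gap: "\<And>i j. i \<in> {1..m} \<Longrightarrow> j \<in> {1..m} \<Longrightarrow> i \<noteq> j \<Longrightarrow> \<epsilon> < \<bar>c i - c j\<bar>"
    and eps_min: "c m \<noteq> 0 \<Longrightarrow> \<epsilon> < c m"
    and sorting: "\<And>z. sorts (\<sigma> z) (beta_at \<beta> (c k) z)"
  shows "let xt = x_tilde X \<beta> (c k);
             r = y - X *v \<beta>;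
             G = G_obj \<sigma> lam X y \<beta> (c k);
             T = slope_threshold (S_sum \<sigma> lam \<beta> (c k)) \<epsilon>
                   (c k * (norm xt)\<^sup>2 + inner xt r) ((norm xt)\<^sup>2) (c ` ({1..m} - {k}))
         in is_arg_min G (\<lambda>_. True) T \<and>
            (xt \<noteq> 0 \<longrightarrow> (\<forall>z. is_arg_min G (\<lambda>_. True) z \<longrightarrow> z = T))"
proof -
  define v where "v = c k"
  define xt where "xt = x_tilde X \<beta> v"
  define \<omega> where "\<omega> = (norm xt)\<^sup>2"
  define \<gamma> where "\<gamma> = v * \<omega> + inner xt (y - X *v \<beta>)"
  define A where "A = c ` ({1..m} - {k})"
  define T where "T = slope_threshold (S_sum \<sigma> lam \<beta> v) \<epsilon> \<gamma> \<omega> A"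
  have c_image: "c ` {1..m} = {\<bar>\<beta> $ j\<bar> | j. True}"
    and c_less: "\<And>i j. i \<in> {1..m} \<Longrightarrow> j \<in> {1..m} \<Longrightarrow> i < j \<Longrightarrow> c j < c i"
    using clusters by (auto simp: cluster_values_def)
  have c_nonneg: "0 \<le> c i" if "i \<in> {1..m}" for i
  proof -
    have "c i \<in> {\<bar>\<beta> $ j\<bar> | j. True}" using that c_image by blast
    then show ?thesis by auto
  qed
  have sort: "\<And>z. sorts (\<sigma> z) (beta_at \<beta> v z)" using sorting by (simp add: v_def)
  have A0: "a = 0 \<or> \<epsilon> < a" if "a \<in> A" for a
  proof -
    obtain i where i: "i \<in> {1..m}" "a = c i" using \<open>a \<in> A\<close> unfolding A_def by blast
    have m: "m \<in> {1..m}" using k by auto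
    show ?thesis
    proof (cases "i = m")
      case True
      then show ?thesis using eps_min i by auto
    next
      case False
      then show ?thesis using eps_gap[OF i(1) m] c_less[OF i(1) m] c_nonneg[OF m] i by auto
    qed
  qed
  have other: "\<bar>\<beta> $ j\<bar> \<in> A" if "j \<notin> cluster \<beta> v" for j
  proof -
    have "\<bar>\<beta> $ j\<bar> \<in> c ` {1..m}" using c_image by auto
    then show ?thesis using that by (auto simp: A_def cluster_def v_def)
  qed
  have lam0: "0 \<le> lam i" if "i \<in> {1..CARD('p)}" for i
    using lam_decreasing[of i "CARD('p)"] lam_nonneg that by force
  have S0: "0 \<le> S_sum \<sigma> lam \<beta> v \<epsilon>"
    unfolding S_sum_def
    using sort[of \<epsilon>] by (intro sum_nonneg lam0 rank_of_bounds) (simp add: sorts_def)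
  have small: "0 < \<omega> \<or> \<bar>\<gamma>\<bar> \<le> S_sum \<sigma> lam \<beta> v \<epsilon>"
    using S0 by (cases "xt = 0") (auto simp: \<omega>_def \<gamma>_def)
  obtain t s where ts: "T = sign1 \<gamma> * t" "0 \<le> t"
    "\<And>z. H_norm \<sigma> lam \<beta> v T + s * (\<bar>z\<bar> - t) \<le> H_norm \<sigma> lam \<beta> v z"
    "\<bar>\<gamma>\<bar> = \<omega> * t + s \<or> t = 0 \<and> \<bar>\<gamma>\<bar> \<le> s" "\<gamma> = 0 \<Longrightarrow> t = 0"
  proof (rule slope_threshold_subgradient[of A \<epsilon> "S_sum \<sigma> lam \<beta> v" "H_norm \<sigma> lam \<beta> v" \<omega> \<gamma>])
    show "\<epsilon> < \<bar>a - b\<bar>" if "a \<in> A" "b \<in> A" "a \<noteq> b" for a b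
    proof -
      obtain i j where "i \<in> {1..m}" "j \<in> {1..m}" "a = c i" "b = c j"
        using \<open>a \<in> A\<close> \<open>b \<in> A\<close> unfolding A_def by blast
      then show ?thesis using eps_gap[of i j] \<open>a \<noteq> b\<close> by blast
    qed
    show "H_norm \<sigma> lam \<beta> v t + S_sum \<sigma> lam \<beta> v x * (\<bar>z\<bar> - \<bar>t\<bar>) \<le> H_norm \<sigma> lam \<beta> v z"
      if "0 < x" and gap: "\<And>a. a \<in> A \<Longrightarrow> a < x \<and> a \<le> \<bar>t\<bar> \<or> x < a \<and> \<bar>t\<bar> \<le> a" for x t z
      using sort lam_decreasing
    proof (rule H_norm_subgradient)
      fix j assume "j \<notin> cluster \<beta> v"
      from gap[OF other[OF this]] \<open>0 < x\<close>
      show "\<bar>\<beta> $ j\<bar> < \<bar>x\<bar> \<and> \<bar>\<beta> $ j\<bar> \<le> \<bar>t\<bar> \<or> \<bar>x\<bar> < \<bar>\<beta> $ j\<bar> \<and> \<bar>t\<bar> \<le> \<bar>\<beta> $ j\<bar>"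
        by simp
    qed
  qed (use eps_pos A0 S0 small in \<open>auto simp: A_def T_def\<close>)
  have quadratic: "G_obj \<sigma> lam X y \<beta> v z =
      ((norm (y - X *v \<beta>))\<^sup>2 / 2 + v * inner xt (y - X *v \<beta>) + \<omega> * v\<^sup>2 / 2)
       + \<omega> * z\<^sup>2 / 2 - \<gamma> * z + H_norm \<sigma> lam \<beta> v z" for z
    unfolding \<gamma>_def \<omega>_def xt_def by (rule G_obj_quadratic)
  have \<omega>: "0 \<le> \<omega>" by (simp add: \<omega>_def)
  note min = arg_min_of_subgradient[of "G_obj \<sigma> lam X y \<beta> v", OF quadratic \<omega> ts]
  have "is_arg_min (G_obj \<sigma> lam X y \<beta> v) (\<lambda>_. True) T \<and>
      (xt \<noteq> 0 \<longrightarrow> (\<forall>z. is_arg_min (G_obj \<sigma> lam X y \<beta> v) (\<lambda>_. True) z \<longrightarrow> z = T))"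
    using min by (simp add: \<omega>_def)
  then show ?thesis
    unfolding T_def A_def \<gamma>_def \<omega>_def xt_def v_def Let_def .
qed

end
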